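(* Let $R=\mathbb{Z}[u_1^{\pm1},\dots,u_d^{\pm1}]$, and let $M_A\cong R^k/AR^n$ be a finitely presented $R$-module, where $A$ is a $k\times n$ matrix over $R$. If $k=n$ and $A$ has maximal rank, then the associated prime ideals of $M_A$ are all given by irreducible factors of $\det(A)$; that is, every associated prime ideal of $M_A$ is a principal ideal $\langle\pi\rangle$ generated by an irreducible factor $\pi$ of $\det(A)$ in $R$.
   Context: $R$ is the ring of Laurent polynomials with integer coefficients in $d$ commuting variables; it is a unique factorization domain. A prime ideal $P\subset R$ is associated to an $R$-module $M$ if there is an element $m\in M$ with $P=\{f\in R : f\cdot m=0\}$. Maximal rank for a $k\times k$ matrix means rank $k$. *)

theory Defs
  imports
    "HOL-Algebra.Ideal"
    "HOL-Library.Countable"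
    "HOL-Computational_Algebra.Polynomial_Factorial"
    "Jordan_Normal_Form.Determinant"
    "Jordan_Normal_Form.DL_Rank"
    "HOL-Library.Poly_Mapping"
begin

text \<open>
  The ring \<open>\<int>[u\<^sub>1\<^sup>\<plusminus>\<^sup>1, \<dots>, u\<^sub>d\<^sup>\<plusminus>\<^sup>1]\<close> is the group ring of \<open>\<int>\<^sup>d\<close>, i.e. finitely supported functions from
  exponent vectors to integers with the convolution product. The variables are indexed by a finite
  type \<open>'d\<close>, so \<open>d = CARD('d)\<close>. A type copy is needed because the library makes \<open>'a \<Rightarrow>\<^sub>0 'b\<close> an
  integral domain only for linearly ordered \<open>'a\<close>.
\<close>

typedef ('d :: finite) laurent = "UNIV :: (('d \<Rightarrow>\<^sub>0 int) \<Rightarrow>\<^sub>0 int) set"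
  morphisms poly_of_laurent laurent_of_poly ..

setup_lifting type_definition_laurent

instantiation laurent :: (finite) comm_ring_1
begin

lift_definition zero_laurent :: "'a laurent" is 0 .
lift_definition one_laurent :: "'a laurent" is 1 .
lift_definition plus_laurent :: "'a laurent \<Rightarrow> 'a laurent \<Rightarrow> 'a laurent" is "(+)" .
lift_definition minus_laurent :: "'a laurent \<Rightarrow> 'a laurent \<Rightarrow> 'a laurent" is "(-)" .
lift_definition uminus_laurent :: "'a laurent \<Rightarrow> 'a laurent" is uminus .
lift_definition times_laurent :: "'a laurent \<Rightarrow> 'a laurent \<Rightarrow> 'a laurent" is "(*)" .

instance
  by standard (transfer; simp add: algebra_simps)+

end

text \<open>
  Exponent vectors embed additively into the linearly ordered group \<open>nat \<Rightarrow>\<^sub>0 int\<close>; the product of the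
  leading terms then shows that there are no zero divisors.
\<close>

lift_definition exponent_embed :: "('d :: finite \<Rightarrow>\<^sub>0 int) \<Rightarrow> (nat \<Rightarrow>\<^sub>0 int)" is
  "\<lambda>f n. if n \<in> range (to_nat :: 'd \<Rightarrow> nat) then f (from_nat n) else 0"
  by (rule finite_subset[of _ "range (to_nat :: 'd \<Rightarrow> nat)"]) auto

lemma exponent_embed_add: "exponent_embed (x + y) = exponent_embed x + exponent_embed y"
  by transfer auto

lemma inj_exponent_embed: "inj exponent_embed"
proof (rule injI, transfer)
  fix f g :: "'d :: finite \<Rightarrow> int"
  assume *: "(\<lambda>n. if n \<in> range (to_nat :: 'd \<Rightarrow> nat) then f (from_nat n) else 0) =
    (\<lambda>n. if n \<in> range (to_nat :: 'd \<Rightarrow> nat) then g (from_nat n) else 0)"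
  show "f = g"
  proof
    fix i show "f i = g i"
      using fun_cong[OF *, of "to_nat i"] by simp
  qed
qed

lemma leading_exponent:
  fixes f :: "('d :: finite \<Rightarrow>\<^sub>0 int) \<Rightarrow>\<^sub>0 int"
  assumes "f \<noteq> 0"
  obtains a where "Poly_Mapping.lookup f a \<noteq> 0"
    "\<And>x. Poly_Mapping.lookup f x \<noteq> 0 \<Longrightarrow> exponent_embed x \<le> exponent_embed a"
proof -
  have ne: "Poly_Mapping.keys f \<noteq> {}" using assms by simp
  then have "Max (exponent_embed ` Poly_Mapping.keys f) \<in> exponent_embed ` Poly_Mapping.keys f"
    by (intro Max_in) auto
  then obtain a where a: "a \<in> Poly_Mapping.keys f" "exponent_embed a = Max (exponent_embed ` Poly_Mapping.keys f)"
    by auto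
  show ?thesis
    by (rule that[of a]) (use a in \<open>auto simp: in_keys_iff\<close>)
qed

instance laurent :: (finite) idom
proof (standard, transfer)
  fix f g :: "('a \<Rightarrow>\<^sub>0 int) \<Rightarrow>\<^sub>0 int"
  assume "f \<noteq> 0" and "g \<noteq> 0"
  from leading_exponent[OF \<open>f \<noteq> 0\<close>] obtain a where a: "Poly_Mapping.lookup f a \<noteq> 0"
    "\<And>x. Poly_Mapping.lookup f x \<noteq> 0 \<Longrightarrow> exponent_embed x \<le> exponent_embed a" by blast
  from leading_exponent[OF \<open>g \<noteq> 0\<close>] obtain b where b: "Poly_Mapping.lookup g b \<noteq> 0"
    "\<And>x. Poly_Mapping.lookup g x \<noteq> 0 \<Longrightarrow> exponent_embed x \<le> exponent_embed b" by blast
  have unique: "x = a" if "Poly_Mapping.lookup f x \<noteq> 0" "Poly_Mapping.lookup g y \<noteq> 0" "a + b = x + y" for x y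
  proof -
    have "exponent_embed a + exponent_embed b = exponent_embed x + exponent_embed y"
      using that(3) by (metis exponent_embed_add)
    with a(2)[OF that(1)] b(2)[OF that(2)] have "exponent_embed x = exponent_embed a"
      by (metis add_less_le_mono less_irrefl order_le_less)
    then show ?thesis using inj_exponent_embed by (auto dest: injD)
  qed
  have "Poly_Mapping.lookup f x * (\<Sum>y. Poly_Mapping.lookup g y when a + b = x + y) = (Poly_Mapping.lookup f a * Poly_Mapping.lookup g b when x = a)"
    for x
  proof (cases "x = a")
    case True
    then show ?thesis by simp
  next
    case False
    then have "Poly_Mapping.lookup f x = 0 \<or> (\<forall>y. (Poly_Mapping.lookup g y when a + b = x + y) = 0)"
      using unique by (auto simp: when_def)
    then show ?thesis using False by auto
  qed
  then have "Poly_Mapping.lookup (f * g) (a + b) = Poly_Mapping.lookup f a * Poly_Mapping.lookup g b"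
    by (simp add: lookup_mult)
  then show "f * g \<noteq> 0" using a(1) b(1) by auto
qed

text \<open>
  As in \<^const>\<open>module_vec\<close>, the fields \<open>mult\<close> and \<open>one\<close>, which the module record inherits from rings,
  play no role.
\<close>

definition quot_module :: "('a, 'b, 'c) module_scheme \<Rightarrow> 'b set \<Rightarrow> ('a, 'b set) module" where
  "quot_module M N = \<lparr>
    carrier = a_rcosets\<^bsub>M\<^esub> N,
    mult = undefined,
    one = undefined,
    zero = N,
    add = set_add M,
    smult = (\<lambda>r X. \<Union>x\<in>X. N +>\<^bsub>M\<^esub> (r \<odot>\<^bsub>M\<^esub> x))\<rparr>"

definition cokernel :: "'a :: comm_ring_1 mat \<Rightarrow> ('a, 'a vec set) module" where
  "cokernel A = quot_module (module_vec TYPE('a) (dim_row A))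
     ((\<lambda>x. A *\<^sub>v x) ` carrier_vec (dim_col A))"

definition module_iso ::
  "('a, 'r) ring_scheme \<Rightarrow> ('a, 'b, 'm) module_scheme \<Rightarrow> ('a, 'c, 'n) module_scheme \<Rightarrow> bool" where
  "module_iso R M N \<longleftrightarrow> (\<exists>\<phi>. mod_hom R M N \<phi> \<and> bij_betw \<phi> (carrier M) (carrier N))"

definition associated_prime ::
  "('a, 'r) ring_scheme \<Rightarrow> ('a, 'b, 'm) module_scheme \<Rightarrow> 'a set \<Rightarrow> bool" where
  "associated_prime R M P \<longleftrightarrow>
     primeideal P R \<and> (\<exists>m \<in> carrier M. P = {f \<in> carrier R. f \<odot>\<^bsub>M\<^esub> m = \<zero>\<^bsub>M\<^esub>})"

lemma module_quot_module:
  assumes "submodule R N M"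
  shows "Module.module R (quot_module M N)"
proof -
  interpret S: submodule R N M by fact
  interpret M: Module.module R M by (rule S.module)
  have neg: "\<ominus>\<^bsub>M\<^esub> v \<in> N" if "v \<in> N" for v
  proof -
    have v: "v \<in> carrier M" using that S.subset by auto
    have "(\<ominus>\<^bsub>R\<^esub> \<one>\<^bsub>R\<^esub>) \<odot>\<^bsub>M\<^esub> v \<in> N"
      using that by (intro S.smult_closed) auto
    then show ?thesis using v by (simp add: M.smult_l_minus)
  qed
  have "N \<noteq> {}" using S.zero_closed by blast
  then have "subgroup N (add_monoid M)"
    by (intro M.add.subgroupI) (use S.subset neg in \<open>auto simp: a_inv_def\<close>)
  then have "additive_subgroup N M"
    by (rule additive_subgroupI)
  then interpret N: abelian_subgroup N M
    by (rule abelian_subgroupI3[OF _ M.abelian_group_axioms])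
  let ?Q = "quot_module M N"
  have rep: "\<exists>x\<in>carrier M. X = N +>\<^bsub>M\<^esub> x" if "X \<in> carrier ?Q" for X
    using that by (auto simp: quot_module_def A_RCOSETS_def' )
  have coset: "N +>\<^bsub>M\<^esub> x \<in> carrier ?Q" if "x \<in> carrier M" for x
    using that by (auto simp: quot_module_def A_RCOSETS_def')
  have add: "(N +>\<^bsub>M\<^esub> x) \<oplus>\<^bsub>?Q\<^esub> (N +>\<^bsub>M\<^esub> y) = N +>\<^bsub>M\<^esub> (x \<oplus>\<^bsub>M\<^esub> y)"
    if "x \<in> carrier M" "y \<in> carrier M" for x y
    using that by (simp add: quot_module_def N.a_rcos_sum)
  have smult: "r \<odot>\<^bsub>?Q\<^esub> (N +>\<^bsub>M\<^esub> x) = N +>\<^bsub>M\<^esub> (r \<odot>\<^bsub>M\<^esub> x)"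
    if r: "r \<in> carrier R" and x: "x \<in> carrier M" for r x
  proof -
    have "N +>\<^bsub>M\<^esub> (r \<odot>\<^bsub>M\<^esub> y) = N +>\<^bsub>M\<^esub> (r \<odot>\<^bsub>M\<^esub> x)" if y: "y \<in> N +>\<^bsub>M\<^esub> x" for y
    proof -
      from y obtain h where h: "h \<in> N" "y = h \<oplus>\<^bsub>M\<^esub> x"
        by (auto simp: a_r_coset_def')
      then have "r \<odot>\<^bsub>M\<^esub> y = r \<odot>\<^bsub>M\<^esub> h \<oplus>\<^bsub>M\<^esub> r \<odot>\<^bsub>M\<^esub> x"
        using r x S.subset by (auto simp: M.smult_r_distr)
      then have "r \<odot>\<^bsub>M\<^esub> y \<in> N +>\<^bsub>M\<^esub> (r \<odot>\<^bsub>M\<^esub> x)"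
        using h r by (auto simp: a_r_coset_def')
      from M.a_repr_independence[OF this M.smult_closed[OF r x] N.a_subgroup]
      show ?thesis ..
    qed
    moreover have "x \<in> N +>\<^bsub>M\<^esub> x" using x by (rule N.a_rcos_self)
    ultimately have "(\<Union>y\<in>N +>\<^bsub>M\<^esub> x. N +>\<^bsub>M\<^esub> (r \<odot>\<^bsub>M\<^esub> y)) = N +>\<^bsub>M\<^esub> (r \<odot>\<^bsub>M\<^esub> x)"
      by (intro SUP_eq_const) blast+
    then show ?thesis by (simp only: quot_module_def module.simps)
  qed
  have zero: "\<zero>\<^bsub>?Q\<^esub> = N +>\<^bsub>M\<^esub> \<zero>\<^bsub>M\<^esub>"
    using S.subset by (simp add: quot_module_def)
  have "abelian_group ?Q"
  proof (rule abelian_groupI)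
    show "\<zero>\<^bsub>?Q\<^esub> \<in> carrier ?Q" unfolding zero by (rule coset) simp
  next
    fix X Y assume "X \<in> carrier ?Q" "Y \<in> carrier ?Q"
    then obtain x y where [simp]: "X = N +>\<^bsub>M\<^esub> x" "x \<in> carrier M" "Y = N +>\<^bsub>M\<^esub> y" "y \<in> carrier M"
      using rep by metis
    show "X \<oplus>\<^bsub>?Q\<^esub> Y \<in> carrier ?Q" by (simp add: add coset)
    show "X \<oplus>\<^bsub>?Q\<^esub> Y = Y \<oplus>\<^bsub>?Q\<^esub> X" by (simp add: add M.a_comm)
  next
    fix X Y Z assume "X \<in> carrier ?Q" "Y \<in> carrier ?Q" "Z \<in> carrier ?Q"
    then obtain x y z where "X = N +>\<^bsub>M\<^esub> x" "x \<in> carrier M" "Y = N +>\<^bsub>M\<^esub> y" "y \<in> carrier M"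
      "Z = N +>\<^bsub>M\<^esub> z" "z \<in> carrier M"
      using rep by metis
    then show "(X \<oplus>\<^bsub>?Q\<^esub> Y) \<oplus>\<^bsub>?Q\<^esub> Z = X \<oplus>\<^bsub>?Q\<^esub> (Y \<oplus>\<^bsub>?Q\<^esub> Z)"
      by (simp add: add M.a_assoc)
  next
    fix X assume "X \<in> carrier ?Q"
    then obtain x where x: "x \<in> carrier M" "X = N +>\<^bsub>M\<^esub> x" using rep by blast
    then show "\<zero>\<^bsub>?Q\<^esub> \<oplus>\<^bsub>?Q\<^esub> X = X" by (simp add: zero add del: M.a_coset_add_zero)
    have "(N +>\<^bsub>M\<^esub> (\<ominus>\<^bsub>M\<^esub> x)) \<oplus>\<^bsub>?Q\<^esub> X = \<zero>\<^bsub>?Q\<^esub>"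
      using x by (simp add: zero add M.l_neg)
    then show "\<exists>Y\<in>carrier ?Q. Y \<oplus>\<^bsub>?Q\<^esub> X = \<zero>\<^bsub>?Q\<^esub>"
      using coset[OF M.a_inv_closed[OF x(1)]] by blast
  qed
  then show ?thesis
  proof (rule moduleI[OF M.R.cring_axioms])
    fix a X assume a: "a \<in> carrier R" and "X \<in> carrier ?Q"
    then obtain x where [simp]: "X = N +>\<^bsub>M\<^esub> x" "x \<in> carrier M" using rep by metis
    show "a \<odot>\<^bsub>?Q\<^esub> X \<in> carrier ?Q" using a by (simp add: smult coset)
    fix b assume b: "b \<in> carrier R"
    show "(a \<oplus>\<^bsub>R\<^esub> b) \<odot>\<^bsub>?Q\<^esub> X = a \<odot>\<^bsub>?Q\<^esub> X \<oplus>\<^bsub>?Q\<^esub> b \<odot>\<^bsub>?Q\<^esub> X"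
      using a b by (simp add: smult add M.smult_l_distr)
    show "(a \<otimes>\<^bsub>R\<^esub> b) \<odot>\<^bsub>?Q\<^esub> X = a \<odot>\<^bsub>?Q\<^esub> (b \<odot>\<^bsub>?Q\<^esub> X)"
      using a b by (simp add: smult M.smult_assoc1)
  next
    fix a X Y assume a: "a \<in> carrier R" and "X \<in> carrier ?Q" "Y \<in> carrier ?Q"
    then obtain x y where "X = N +>\<^bsub>M\<^esub> x" "x \<in> carrier M" "Y = N +>\<^bsub>M\<^esub> y" "y \<in> carrier M"
      using rep by metis
    then show "a \<odot>\<^bsub>?Q\<^esub> (X \<oplus>\<^bsub>?Q\<^esub> Y) = a \<odot>\<^bsub>?Q\<^esub> X \<oplus>\<^bsub>?Q\<^esub> a \<odot>\<^bsub>?Q\<^esub> Y"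
      using a by (simp add: smult add M.smult_r_distr)
  next
    fix X assume "X \<in> carrier ?Q"
    then obtain x where "X = N +>\<^bsub>M\<^esub> x" "x \<in> carrier M" using rep by metis
    then show "\<one>\<^bsub>R\<^esub> \<odot>\<^bsub>?Q\<^esub> X = X" by (simp add: smult)
  qed
qed

lemma module_cokernel:
  fixes A :: "'a :: comm_ring_1 mat"
  shows "Module.module class_ring (cokernel A)"
proof -
  let ?V = "module_vec TYPE('a) (dim_row A)"
  have V: "Module.module class_ring ?V"
    by unfold_locales (auto simp: module_vec_simps class_ring_simps Units_def
      add_smult_distrib_vec smult_add_distrib_vec intro!: bexI[of _ "- _"])
  have "submodule class_ring ((\<lambda>x. A *\<^sub>v x) ` carrier_vec (dim_col A)) ?V"
  proof (rule submodule.intro)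
    show "Module.module class_ring ?V" by (rule V)
    show "(\<lambda>x. A *\<^sub>v x) ` carrier_vec (dim_col A) \<subseteq> carrier ?V"
      by (auto simp: module_vec_simps intro!: carrier_vecI)
    show "\<zero>\<^bsub>?V\<^esub> \<in> (\<lambda>x. A *\<^sub>v x) ` carrier_vec (dim_col A)"
      by (rule image_eqI[of _ _ "0\<^sub>v (dim_col A)"]) (auto simp: module_vec_simps)
  next
    fix v w assume "v \<in> (\<lambda>x. A *\<^sub>v x) ` carrier_vec (dim_col A)"
      "w \<in> (\<lambda>x. A *\<^sub>v x) ` carrier_vec (dim_col A)"
    then obtain x y where "v = A *\<^sub>v x" "w = A *\<^sub>v y"
      "x \<in> carrier_vec (dim_col A)" "y \<in> carrier_vec (dim_col A)" by auto
    then show "v \<oplus>\<^bsub>?V\<^esub> w \<in> (\<lambda>x. A *\<^sub>v x) ` carrier_vec (dim_col A)"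
      by (intro image_eqI[of _ _ "x + y"])
        (auto simp: module_vec_simps mult_add_distrib_mat_vec[of A "dim_row A" "dim_col A"])
  next
    fix c :: 'a and v assume "v \<in> (\<lambda>x. A *\<^sub>v x) ` carrier_vec (dim_col A)"
    then obtain x where "v = A *\<^sub>v x" "x \<in> carrier_vec (dim_col A)" by auto
    then show "c \<odot>\<^bsub>?V\<^esub> v \<in> (\<lambda>x. A *\<^sub>v x) ` carrier_vec (dim_col A)"
      by (intro image_eqI[of _ _ "c \<cdot>\<^sub>v x"])
        (auto simp: module_vec_simps intro!: eq_vecI)
  qed
  then show ?thesis
    unfolding cokernel_def by (rule module_quot_module)
qed

end

theory Submission
  imports Defs
begin

text \<open>
  Multiplying by the adjugate turns membership in the image of \<open>A\<close> into divisibility: as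
  \<open>D = det A\<close> is nonzero, \<open>v\<close> lies in \<open>A R\<^sup>n\<close> iff \<open>D\<close> divides every entry of \<open>adj A \<cdot> v\<close>. So the
  annihilator of the class of \<open>v\<close> in the cokernel is the set \<open>P\<close> of all \<open>f\<close> such that \<open>D\<close> divides
  every \<open>f w\<^sub>i\<close>, where \<open>w = adj A \<cdot> v\<close>. Suppose that \<open>P\<close> is prime. It contains \<open>D\<close>, which is a
  unit times a product of primes, hence it contains a prime element \<open>p\<close>. Comparing \<open>D\<close> with the multiples
  \<open>p w\<^sub>i\<close> forces \<open>D = p E\<close> and \<open>w\<^sub>i = E v\<^sub>i\<close>, so \<open>P\<close> consists of the \<open>f\<close> with \<open>p\<close> dividing every
  \<open>f v\<^sub>i\<close>; since some \<open>v\<^sub>i\<close> is not divisible by \<open>p\<close>, this is the principal ideal of \<open>p\<close>. This is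
  \<open>prime_colon_ideal_principal\<close>.

  The argument needs prime factorisations in the ring of Laurent polynomials
  (\<open>factorial_laurent\<close>). They come from Gauss's theorem by induction on the number of variables. The
  number of variables is the cardinality of a type, so there is no induction over a tower of
  polynomial types; instead, factoriality is stated for subsets \<open>S\<close> of an integral domain that are
  closed under the ring operations. If \<open>S\<close> is factorial, so are the polynomials with coefficients
  in \<open>S\<close> (\<open>factorial_polys_over\<close>), hence also the ring obtained from \<open>S\<close> by adjoining an element
  transcendental over it, which is their image under evaluation. Starting from the integers and
  adjoining all variables gives the ordinary polynomials inside the Laurent polynomials, and
  inverting the monomials preserves factoriality (\<open>factorial_localization\<close>).

  Gauss's theorem is proved without fraction fields. Every nonzero polynomial over \<open>S\<close> is a constant
  times a primitive polynomial, and a primitive divisor of \<open>s f\<close> with \<open>s\<close> a nonzero constant divides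
  \<open>f\<close>, because primes of \<open>S\<close> remain prime in the polynomial ring. With pseudo-division this makes
  every ideal from which nonzero constants can be cancelled principal (\<open>ideal_principal\<close>), a
  substitute for the principal ideals over the fraction field. It follows that a primitive divisor
  of least positive degree is prime, and splitting off such divisors factors every primitive
  polynomial.
\<close>

section \<open>Factorisation in subrings of an integral domain\<close>

text \<open>
  Divisibility and primality depend on the subring: a prime of \<open>S\<close> can be a unit in the ambient
  domain. All notions therefore carry \<open>S\<close> as a parameter.
\<close>

definition dvd_in :: "'a :: idom set \<Rightarrow> 'a \<Rightarrow> 'a \<Rightarrow> bool" where
  "dvd_in S a b \<longleftrightarrow> (\<exists>c\<in>S. b = a * c)"

definition prime_in :: "'a :: idom set \<Rightarrow> 'a \<Rightarrow> bool" where
  "prime_in S p \<longleftrightarrow> p \<in> S \<and> p \<noteq> 0 \<and> \<not> dvd_in S p 1 \<and>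
     (\<forall>a\<in>S. \<forall>b\<in>S. dvd_in S p (a * b) \<longrightarrow> dvd_in S p a \<or> dvd_in S p b)"

inductive_set prime_products :: "'a :: idom set \<Rightarrow> 'a set" for S where
  unit: "u \<in> S \<Longrightarrow> dvd_in S u 1 \<Longrightarrow> u \<in> prime_products S"
| prime: "prime_in S p \<Longrightarrow> x \<in> prime_products S \<Longrightarrow> p * x \<in> prime_products S"

locale subdomain =
  fixes S :: "'a :: idom set"
  assumes zero_closed [simp]: "0 \<in> S"
    and one_closed [simp]: "1 \<in> S"
    and diff_closed [simp]: "a \<in> S \<Longrightarrow> b \<in> S \<Longrightarrow> a - b \<in> S"
    and mult_closed [simp]: "a \<in> S \<Longrightarrow> b \<in> S \<Longrightarrow> a * b \<in> S"
begin

lemma uminus_closed [simp]: "a \<in> S \<Longrightarrow> - a \<in> S"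
  using diff_closed[of 0 a] by simp

lemma add_closed [simp]: "a \<in> S \<Longrightarrow> b \<in> S \<Longrightarrow> a + b \<in> S"
  using diff_closed[of a "- b"] by simp

lemma sum_closed: "(\<And>i. i \<in> I \<Longrightarrow> f i \<in> S) \<Longrightarrow> sum f I \<in> S"
  by (induction I rule: infinite_finite_induct) auto

lemma dvd_in_trans: "dvd_in S a b \<Longrightarrow> dvd_in S b c \<Longrightarrow> dvd_in S a c"
  unfolding dvd_in_def by (metis mult.assoc mult_closed)

lemma dvd_in_mult: "dvd_in S a b \<Longrightarrow> c \<in> S \<Longrightarrow> dvd_in S a (b * c)"
  unfolding dvd_in_def by (metis mult.assoc mult_closed)

lemma dvd_in_mult_left: "dvd_in S a b \<Longrightarrow> c \<in> S \<Longrightarrow> dvd_in S a (c * b)"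
  using dvd_in_mult[of a b c] by (simp add: mult.commute)

lemma dvd_in_triv: "c \<in> S \<Longrightarrow> dvd_in S a (a * c)"
  unfolding dvd_in_def by auto

lemma dvd_in_add: "dvd_in S a b \<Longrightarrow> dvd_in S a c \<Longrightarrow> dvd_in S a (b + c)"
  unfolding dvd_in_def by (metis add_closed distrib_left)

lemma dvd_in_diff: "dvd_in S a b \<Longrightarrow> dvd_in S a c \<Longrightarrow> dvd_in S a (b - c)"
  unfolding dvd_in_def by (metis diff_closed right_diff_distrib)

lemma dvd_in_sum: "(\<And>i. i \<in> I \<Longrightarrow> dvd_in S a (f i)) \<Longrightarrow> dvd_in S a (sum f I)"
  by (induction I rule: infinite_finite_induct)
    (auto simp: dvd_in_add, (auto simp: dvd_in_def intro: bexI[of _ 0]))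

lemma dvd_in_cancel: "c \<noteq> 0 \<Longrightarrow> dvd_in S (c * a) (c * b) \<longleftrightarrow> dvd_in S a b"
  unfolding dvd_in_def by (simp add: mult.assoc)

lemma prime_products_nonzero: "x \<in> prime_products S \<Longrightarrow> x \<in> S \<and> x \<noteq> 0"
  by (induction rule: prime_products.induct) (auto simp: prime_in_def dvd_in_def)

lemma prime_products_unit_mult:
  assumes "x \<in> prime_products S" "u \<in> S" "dvd_in S u 1"
  shows "u * x \<in> prime_products S"
  using assms
proof (induction rule: prime_products.induct)
  case (unit v)
  have "dvd_in S (u * v) 1"
    using unit unfolding dvd_in_def by (metis mult.assoc mult.left_commute mult_1_right mult_closed)
  then show ?case using unit by (intro prime_products.unit) auto
next
  case (prime p x)
  then show ?case using prime_products.prime[of S p "u * x"] by (simp add: mult.left_commute)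
qed

lemma prime_products_mult:
  assumes "x \<in> prime_products S" "y \<in> prime_products S"
  shows "x * y \<in> prime_products S"
  using assms
  by (induction rule: prime_products.induct)
    (auto simp: prime_products_unit_mult mult.assoc intro: prime_products.prime)

end

locale factorial_subdomain = subdomain +
  assumes factorial: "x \<in> S \<Longrightarrow> x \<noteq> 0 \<Longrightarrow> x \<in> prime_products S"

section \<open>Gauss: polynomials over a factorial domain\<close>

definition polys_over :: "'a :: idom set \<Rightarrow> 'a poly set" where
  "polys_over S = {p. \<forall>i. coeff p i \<in> S}"

context subdomain
begin

lemma subdomain_polys_over: "subdomain (polys_over S)"
proof
  fix p q assume "p \<in> polys_over S" "q \<in> polys_over S"
  then show "p * q \<in> polys_over S" "p - q \<in> polys_over S"
    by (auto simp: polys_over_def coeff_mult intro!: sum_closed)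
qed (auto simp: polys_over_def)

interpretation poly: subdomain "polys_over S"
  by (rule subdomain_polys_over)

lemma const_in_polys_over [simp]: "[:s:] \<in> polys_over S \<longleftrightarrow> s \<in> S"
  by (auto simp: polys_over_def coeff_pCons split: nat.splits)

lemma monom_in_polys_over: "s \<in> S \<Longrightarrow> monom s n \<in> polys_over S"
  by (auto simp: polys_over_def)

lemma coeff_in: "p \<in> polys_over S \<Longrightarrow> coeff p i \<in> S"
  by (auto simp: polys_over_def)

text \<open>
  Quotients of the coefficients by a nonzero \<open>s\<close> vanish wherever the coefficients do, so they again
  form a polynomial.
\<close>

lemma const_dvd_in_iff:
  assumes "s \<noteq> 0"
  shows "dvd_in (polys_over S) [:s:] f \<longleftrightarrow> (\<forall>i. dvd_in S s (coeff f i))"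
proof
  assume "dvd_in (polys_over S) [:s:] f"
  then show "\<forall>i. dvd_in S s (coeff f i)"
    unfolding dvd_in_def polys_over_def by auto
next
  assume *: "\<forall>i. dvd_in S s (coeff f i)"
  then obtain c where c: "\<And>i. c i \<in> S" "\<And>i. coeff f i = s * c i"
    unfolding dvd_in_def by metis
  have "c i = 0" if "i > degree f" for i
    using c(2)[of i] that assms by (simp add: coeff_eq_0)
  then have "coeff (Abs_poly c) = c"
    by (intro coeff_Abs_poly[of "degree f"]) auto
  then show "dvd_in (polys_over S) [:s:] f"
    unfolding dvd_in_def using c by (intro bexI[of _ "Abs_poly c"]) (auto simp: polys_over_def poly_eq_iff)
qed

lemma const_unit_iff: "s \<in> S \<Longrightarrow> dvd_in (polys_over S) [:s:] 1 \<longleftrightarrow> dvd_in S s 1"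
proof
  assume "dvd_in (polys_over S) [:s:] 1"
  then obtain g where "g \<in> polys_over S" "1 = [:s:] * g" by (auto simp: dvd_in_def)
  then have "coeff 1 0 = coeff ([:s:] * g) 0" by simp
  then have "1 = s * coeff g 0" by simp
  then show "dvd_in S s 1" using \<open>g \<in> _\<close> by (auto simp: dvd_in_def polys_over_def)
next
  assume "dvd_in S s 1"
  then obtain c where "c \<in> S" "1 = s * c" by (auto simp: dvd_in_def)
  then show "dvd_in (polys_over S) [:s:] 1"
    unfolding dvd_in_def by (intro bexI[of _ "[:c:]"]) (auto simp: one_pCons mult.commute)
qed

text \<open>
  Gauss's lemma: if \<open>p\<close> divides neither \<open>f\<close> nor \<open>g\<close>, let \<open>i\<close> and \<open>j\<close> be the least indices of
  coefficients that \<open>p\<close> does not divide. In the coefficient of \<open>f * g\<close> at \<open>i + j\<close> every summand except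
  the product of these two is divisible by \<open>p\<close>.
\<close>

lemma prime_in_const:
  assumes "prime_in S p"
  shows "prime_in (polys_over S) [:p:]"
proof -
  have p: "p \<in> S" "p \<noteq> 0" "\<not> dvd_in S p 1"
    "\<And>a b. a \<in> S \<Longrightarrow> b \<in> S \<Longrightarrow> dvd_in S p (a * b) \<Longrightarrow> dvd_in S p a \<or> dvd_in S p b"
    using assms by (auto simp: prime_in_def)
  have False if f: "f \<in> polys_over S" and g: "g \<in> polys_over S" and fg: "\<And>i. dvd_in S p (coeff (f * g) i)"
    and nf: "\<not> dvd_in S p (coeff f i')" and ng: "\<not> dvd_in S p (coeff g j')" for f g i' j'
  proof -
    define i where "i = (LEAST i. \<not> dvd_in S p (coeff f i))"
    define j where "j = (LEAST j. \<not> dvd_in S p (coeff g j))"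
    have i: "\<not> dvd_in S p (coeff f i)" "\<And>k. k < i \<Longrightarrow> dvd_in S p (coeff f k)"
      unfolding i_def using LeastI[of "\<lambda>i. \<not> dvd_in S p (coeff f i)", OF nf] not_less_Least by blast+
    have j: "\<not> dvd_in S p (coeff g j)" "\<And>k. k < j \<Longrightarrow> dvd_in S p (coeff g k)"
      unfolding j_def using LeastI[of "\<lambda>i. \<not> dvd_in S p (coeff g i)", OF ng] not_less_Least by blast+
    have rest: "dvd_in S p (\<Sum>k\<in>{..i+j} - {i}. coeff f k * coeff g (i + j - k))"
    proof (rule dvd_in_sum)
      fix k assume k: "k \<in> {..i+j} - {i}"
      show "dvd_in S p (coeff f k * coeff g (i + j - k))"
      proof (cases "k < i")
        case True
        then show ?thesis using i(2) g by (auto intro: dvd_in_mult coeff_in)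
      next
        case False
        with k have "i + j - k < j" by auto
        then show ?thesis using j(2) f by (auto intro: dvd_in_mult_left coeff_in)
      qed
    qed
    have "coeff (f * g) (i + j) =
      coeff f i * coeff g j + (\<Sum>k\<in>{..i+j} - {i}. coeff f k * coeff g (i + j - k))"
      by (subst coeff_mult, subst sum.remove[of _ i]) auto
    then have "coeff f i * coeff g j =
      coeff (f * g) (i + j) - (\<Sum>k\<in>{..i+j} - {i}. coeff f k * coeff g (i + j - k))"
      by simp
    then have "dvd_in S p (coeff f i * coeff g j)"
      using dvd_in_diff[OF fg rest] by simp
    with p(4) i(1) j(1) f g show False by (meson coeff_in)
  qed
  then show ?thesis
    using p(1-3) unfolding prime_in_def by (auto simp: const_dvd_in_iff const_unit_iff)
qed

lemma prime_products_const:
  "s \<in> prime_products S \<Longrightarrow> [:s:] \<in> prime_products (polys_over S)"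
proof (induction rule: prime_products.induct)
  case (unit u)
  then show ?case by (intro prime_products.unit) (auto simp: const_unit_iff)
next
  case (prime p x)
  then show ?case using prime_products.prime[OF prime_in_const[of p] prime.IH] by (simp add: mult.commute)
qed

definition primitive :: "'a poly \<Rightarrow> bool" where
  "primitive e \<longleftrightarrow> e \<in> polys_over S \<and> (\<forall>p. prime_in S p \<longrightarrow> \<not> dvd_in (polys_over S) [:p:] e)"

lemma primitive_dvd:
  assumes "primitive f" "f = a * b" "a \<in> polys_over S" "b \<in> polys_over S"
  shows "primitive a" "primitive b"
  using assms poly.dvd_in_mult[of _ a b] poly.dvd_in_mult_left[of _ b a] unfolding primitive_def by metis+

text \<open>
  The prime factors of \<open>s\<close> are cancelled one at a time: a prime \<open>p\<close> dividing \<open>e * q\<close> does not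
  divide the primitive \<open>e\<close>, so it divides \<open>q\<close>.
\<close>

lemma primitive_cancel_const:
  assumes "s \<in> prime_products S" "primitive e" "f \<in> polys_over S"
    and "dvd_in (polys_over S) e ([:s:] * f)"
  shows "dvd_in (polys_over S) e f"
  using assms
proof (induction s arbitrary: f rule: prime_products.induct)
  case (unit u)
  then obtain v where v: "v \<in> S" "1 = u * v" by (auto simp: dvd_in_def)
  have "[:v:] * ([:u:] * f) = [:u * v:] * f" by (simp add: mult.commute)
  also have "\<dots> = f" using v by simp
  finally show ?case
    using poly.dvd_in_mult_left[OF unit.prems(3), of "[:v:]"] v by simp
next
  case (prime p x)
  let ?Q = "polys_over S"
  from prime.prems(3) obtain q where q: "q \<in> ?Q" "[:p * x:] * f = e * q"
    by (auto simp: dvd_in_def)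
  have p: "prime_in ?Q [:p:]" "p \<noteq> 0" using prime.hyps prime_in_const by (auto simp: prime_in_def)
  have x: "x \<in> S" using prime.hyps prime_products_nonzero by auto
  have eq: "[:p:] * ([:x:] * f) = e * q" using q by (simp add: mult.commute)
  then have "dvd_in ?Q [:p:] (e * q)"
    using x prime.prems unfolding dvd_in_def by (intro bexI[of _ "[:x:] * f"]) (auto intro!: poly.mult_closed simp del: mult_pCons_left)
  then have "dvd_in ?Q [:p:] q"
    using p prime.prems(1) q(1) prime.hyps unfolding primitive_def prime_in_def[of ?Q] by blast
  then obtain q' where q': "q' \<in> ?Q" "q = [:p:] * q'" by (auto simp: dvd_in_def)
  have "[:p:] * ([:x:] * f) = [:p:] * (e * q')" using eq q' by (simp only: mult.left_commute)
  then have "[:x:] * f = e * q'" using p by (metis mult_left_cancel pCons_eq_0_iff)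
  then have "dvd_in ?Q e ([:x:] * f)" using q' by (auto simp: dvd_in_def)
  with prime show ?case by blast
qed

end

context factorial_subdomain
begin

interpretation poly: subdomain "polys_over S"
  by (rule subdomain_polys_over)

text \<open>
  The induction runs over a prime factorisation of an element \<open>x\<close> that every constant divisor of \<open>f\<close>
  divides. Each prime of \<open>x\<close> either divides \<open>f\<close> and is split off, or can be dropped from \<open>x\<close>; once
  \<open>x\<close> is a unit, \<open>f\<close> is primitive. The leading coefficient of \<open>f\<close> serves as the initial \<open>x\<close>.
\<close>

lemma extract_content:
  assumes "f \<in> polys_over S" "f \<noteq> 0"
  obtains s g where "s \<in> S" "s \<noteq> 0" "primitive g" "f = [:s:] * g"
proof -
  let ?Q = "polys_over S"
  have "\<exists>s g. s \<in> S \<and> s \<noteq> 0 \<and> primitive g \<and> f = [:s:] * g"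
    if "x \<in> prime_products S" "f \<in> ?Q" "f \<noteq> 0"
      "\<forall>a\<in>S. a \<noteq> 0 \<longrightarrow> dvd_in ?Q [:a:] f \<longrightarrow> dvd_in S a x" for x f
    using that
  proof (induction x arbitrary: f rule: prime_products.induct)
    case (unit u)
    have "primitive f"
      unfolding primitive_def
    proof (intro conjI allI impI notI)
      fix p assume p: "prime_in S p" "dvd_in ?Q [:p:] f"
      then have "dvd_in S p u" using unit by (auto simp: prime_in_def)
      with unit have "dvd_in S p 1" using dvd_in_trans by blast
      with p show False by (auto simp: prime_in_def)
    qed (use unit in auto)
    then show ?case by (intro exI[of _ 1] exI[of _ f]) auto
  next
    case (prime p x)
    have p: "p \<in> S" "p \<noteq> 0" using prime by (auto simp: prime_in_def)
    have x: "x \<in> S" using prime.hyps prime_products_nonzero by auto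
    show ?case
    proof (cases "dvd_in ?Q [:p:] f")
      case True
      then obtain f' where f': "f' \<in> ?Q" "f = [:p:] * f'" by (auto simp: dvd_in_def)
      have "dvd_in S a x" if a: "a \<in> S" "a \<noteq> 0" "dvd_in ?Q [:a:] f'" for a
      proof -
        have "dvd_in ?Q ([:p:] * [:a:]) f" using a f' p by (subst f'(2), subst poly.dvd_in_cancel) auto
        then have "dvd_in ?Q [:p * a:] f" by (simp add: mult.commute)
        then have "dvd_in S (p * a) (p * x)"
          using prime.prems(3)[rule_format, of "p * a"] a p by simp
        then show ?thesis using p dvd_in_cancel by blast
      qed
      then have "\<exists>s g. s \<in> S \<and> s \<noteq> 0 \<and> primitive g \<and> f' = [:s:] * g"
        using prime.IH[of f'] f' prime.prems by auto
      then obtain s g where s: "s \<in> S" "s \<noteq> 0" "primitive g" "f' = [:s:] * g" by blast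
      have "f = [:p * s:] * g" using f' s by (simp add: mult.commute)
      then show ?thesis using s p by (intro exI[of _ "p * s"] exI[of _ g]) auto
    next
      case False
      have "dvd_in S a x" if a: "a \<in> S" "a \<noteq> 0" "dvd_in ?Q [:a:] f" for a
      proof -
        obtain c where c: "c \<in> S" "p * x = a * c"
          using prime.prems(3) a by (auto simp: dvd_in_def)
        have "dvd_in S p (a * c)" using dvd_in_triv[OF x, of p] c by simp
        moreover have "\<not> dvd_in S p a"
        proof
          assume "dvd_in S p a"
          then have "dvd_in ?Q [:p:] [:a:]" by (auto simp: dvd_in_def intro!: bexI[of _ "[:_:]"])
          with a(3) False show False using poly.dvd_in_trans by blast
        qed
        ultimately have "dvd_in S p c" using prime.hyps a c by (auto simp: prime_in_def)
        then obtain d where "d \<in> S" "c = p * d" by (auto simp: dvd_in_def)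
        then have "p * x = p * (a * d)" using c by (simp add: mult.left_commute)
        then have "x = a * d" using p by simp
        then show ?thesis using \<open>d \<in> S\<close> by (auto simp: dvd_in_def)
      qed
      then show ?thesis using prime by blast
    qed
  qed
  from this[OF factorial, of "lead_coeff f" f] assms that show ?thesis
    by (metis coeff_in const_dvd_in_iff leading_coeff_0_iff)
qed

text \<open>
  The hypothesis \<open>saturated\<close> says that \<open>J\<close> is the trace of an ideal over the fraction field of \<open>S\<close>.
  Such an ideal is generated by an element of least degree; the generator is taken primitive, so that
  the constants introduced by pseudo-division can be cancelled.
\<close>

lemma ideal_principal:
  assumes sub: "J \<subseteq> polys_over S"
    and diff: "\<And>f g. f \<in> J \<Longrightarrow> g \<in> J \<Longrightarrow> f - g \<in> J"
    and mult: "\<And>f g. f \<in> J \<Longrightarrow> g \<in> polys_over S \<Longrightarrow> g * f \<in> J"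
    and saturated: "\<And>s f. s \<in> S \<Longrightarrow> s \<noteq> 0 \<Longrightarrow> f \<in> polys_over S \<Longrightarrow> [:s:] * f \<in> J \<Longrightarrow> f \<in> J"
    and nonzero: "f\<^sub>0 \<in> J" "f\<^sub>0 \<noteq> 0"
  obtains e where "e \<in> J" "e \<noteq> 0" "\<And>f. f \<in> J \<Longrightarrow> dvd_in (polys_over S) e f"
proof -
  let ?Q = "polys_over S"
  obtain e0 where e0: "e0 \<in> J" "e0 \<noteq> 0" and min0: "\<And>f. f \<in> J \<Longrightarrow> f \<noteq> 0 \<Longrightarrow> degree e0 \<le> degree f"
    using ex_has_least_nat[of "\<lambda>f. f \<in> J \<and> f \<noteq> 0" f\<^sub>0 degree] nonzero by auto
  obtain s e where s: "s \<in> S" "s \<noteq> 0" "primitive e" "e0 = [:s:] * e"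
    using extract_content[of e0] e0 sub by blast
  have eQ: "e \<in> ?Q" using s by (simp add: primitive_def)
  have e: "e \<in> J" "e \<noteq> 0" using saturated[of s e] s e0 eQ by auto
  have min: "degree e \<le> degree f" if "f \<in> J" "f \<noteq> 0" for f
    using min0[OF that] s by simp
  have lc: "lead_coeff e \<in> S" "lead_coeff e \<noteq> 0" using e eQ coeff_in by auto
  \<comment> \<open>Pseudo-division by \<open>e\<close>: cancelling the leading term of \<open>f\<close> stays inside \<open>J\<close>, where no
    nonzero element has smaller degree than \<open>e\<close>, so the process can only stop at the remainder 0.\<close>
  have "\<exists>s\<in>S. s \<noteq> 0 \<and> dvd_in ?Q e ([:s:] * f)" if "f \<in> J" for f
    using that
  proof (induction "degree f" arbitrary: f rule: less_induct)
    case less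
    have zero: ?case if "f = 0"
      using that by (intro bexI[of _ 1]) (auto simp: dvd_in_def intro!: bexI[of _ 0])
    show ?case
    proof (cases "f = 0")
      case True then show ?thesis by (rule zero)
    next
      case False
      have fQ: "f \<in> ?Q" using less.prems sub by auto
      define m where "m = monom (lead_coeff f) (degree f - degree e)"
      have mQ: "m \<in> ?Q" unfolding m_def by (intro monom_in_polys_over coeff_in fQ)
      define r where "r = [:lead_coeff e:] * f - m * e"
      have rJ: "r \<in> J" unfolding r_def using lc mQ less.prems e by (intro diff mult) auto
      have m0: "m \<noteq> 0" using False by (simp add: m_def)
      have deg: "degree (m * e) = degree f"
        using min[OF less.prems False] m0 e False by (subst degree_mult_eq) (auto simp: m_def degree_monom_eq)
      have "lead_coeff (m * e) = lead_coeff e * lead_coeff f"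
        using False by (simp add: lead_coeff_mult m_def degree_monom_eq lead_coeff_monom mult.commute)
      then have "coeff r (degree f) = 0" using deg by (simp add: r_def)
      moreover have "degree r \<le> degree f"
        unfolding r_def using deg lc by (intro degree_diff_le) auto
      ultimately have "r = 0 \<or> degree r < degree f"
        by (metis leading_coeff_0_iff le_neq_implies_less)
      then have "\<exists>s\<in>S. s \<noteq> 0 \<and> dvd_in ?Q e ([:s:] * r)"
      proof
        assume "r = 0"
        then show ?thesis by (intro bexI[of _ 1]) (auto simp: dvd_in_def intro!: bexI[of _ 0])
      next
        assume "degree r < degree f"
        then show ?thesis using less.hyps rJ by blast
      qed
      then obtain t where t: "t \<in> S" "t \<noteq> 0" "dvd_in ?Q e ([:t:] * r)" by blast
      have "[:t * lead_coeff e:] * f = [:t:] * ([:lead_coeff e:] * f)" by (simp add: mult.commute)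
      also have "\<dots> = [:t:] * r + [:t:] * m * e"
        unfolding r_def by (simp only: right_diff_distrib mult.assoc) simp
      finally have eq: "[:t * lead_coeff e:] * f = [:t:] * r + [:t:] * m * e" .
      have "dvd_in ?Q e ([:t:] * m * e)"
        using t mQ by (auto simp: dvd_in_def mult.commute intro!: bexI[of _ "[:t:] * m"] poly.mult_closed simp del: mult_pCons_left mult_pCons_right)
      with t have "dvd_in ?Q e ([:t * lead_coeff e:] * f)"
        unfolding eq by (intro poly.dvd_in_add)
      then show ?thesis using t lc by (intro bexI[of _ "t * lead_coeff e"]) auto
    qed
  qed
  then have "dvd_in ?Q e f" if "f \<in> J" for f
    using that primitive_cancel_const[OF factorial s(3)] sub by (meson subsetD)
  with e that show ?thesis by blast
qed

lemma primitive_degree_0_unit: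
  assumes "primitive g" "degree g = 0" "g \<noteq> 0"
  shows "dvd_in (polys_over S) g 1"
proof -
  obtain s where s: "g = [:s:]" using assms(2) degree_eq_zeroE by blast
  have sS: "s \<in> S" "s \<noteq> 0" using assms s by (auto simp: primitive_def)
  from factorial[OF this] show ?thesis
  proof cases
    case unit
    then show ?thesis using s const_unit_iff by auto
  next
    case (prime p x)
    then have "dvd_in (polys_over S) [:p:] g"
      using s prime_products_nonzero[of x] by (auto simp: dvd_in_def intro!: bexI[of _ "[:x:]"])
    with prime assms show ?thesis by (auto simp: primitive_def)
  qed
qed

text \<open>
  Let \<open>c\<close> divide \<open>g * h\<close>. The polynomials \<open>f\<close> for which \<open>c\<close> divides \<open>f * h\<close> form a saturated ideal
  containing \<open>c\<close> and \<open>g\<close>. Its generator \<open>e\<close> divides \<open>c\<close>, so by minimality it is a unit, in which case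
  \<open>c\<close> divides \<open>h\<close>, or it differs from \<open>c\<close> by a unit, in which case \<open>c\<close> divides \<open>g\<close>.
\<close>

lemma minimal_divisor_prime:
  assumes c: "primitive c" "degree c > 0"
    and min: "\<And>a b. a \<in> polys_over S \<Longrightarrow> b \<in> polys_over S \<Longrightarrow> c = a * b \<Longrightarrow> degree a > 0 \<Longrightarrow> degree c \<le> degree a"
  shows "prime_in (polys_over S) c"
proof -
  let ?Q = "polys_over S"
  have cQ: "c \<in> ?Q" "c \<noteq> 0" using c by (auto simp: primitive_def)
  have nonunit: "\<not> dvd_in ?Q c 1"
  proof
    assume "dvd_in ?Q c 1"
    then obtain d where "1 = c * d" by (auto simp: dvd_in_def)
    then show False using c(2) by (metis add_is_0 degree_1 degree_mult_eq gr_implies_not0 mult_eq_0_iff one_neq_zero)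
  qed
  have "dvd_in ?Q c g \<or> dvd_in ?Q c h" if g: "g \<in> ?Q" and h: "h \<in> ?Q" and gh: "dvd_in ?Q c (g * h)" for g h
  proof -
    define J where "J = {f \<in> ?Q. dvd_in ?Q c (f * h)}"
    have cJ: "c \<in> J" using cQ h by (auto simp: J_def poly.dvd_in_triv)
    obtain e where e: "e \<in> J" "e \<noteq> 0" "\<And>f. f \<in> J \<Longrightarrow> dvd_in ?Q e f"
    proof (rule ideal_principal[of J c])
      fix s f assume sf: "s \<in> S" "s \<noteq> 0" "f \<in> ?Q" "[:s:] * f \<in> J"
      then have "dvd_in ?Q c ([:s:] * (f * h))" by (simp add: J_def)
      then show "f \<in> J"
        using primitive_cancel_const[OF factorial c(1), of s "f * h"] sf h by (simp add: J_def)
    next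
      fix f k assume "f \<in> J" "k \<in> ?Q"
      then show "k * f \<in> J" by (simp add: J_def mult.assoc poly.dvd_in_mult_left)
    qed (use cJ cQ in \<open>auto simp: J_def left_diff_distrib poly.dvd_in_diff\<close>)
    have eQ: "e \<in> ?Q" "dvd_in ?Q c (e * h)" using e by (auto simp: J_def)
    have "g \<in> J" using g gh by (simp add: J_def)
    with e(3) obtain l where l: "l \<in> ?Q" "g = e * l" by (auto simp: dvd_in_def)
    from e(3)[OF cJ] obtain k where k: "k \<in> ?Q" "c = e * k" by (auto simp: dvd_in_def)
    have ek: "primitive e" "primitive k" using primitive_dvd[OF c(1) k(2)] eQ k by auto
    have k0: "k \<noteq> 0" using k cQ by auto
    show ?thesis
    proof (cases "degree e = 0")
      case True
      then have "dvd_in ?Q e 1" using primitive_degree_0_unit ek e by blast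
      then obtain v where v: "v \<in> ?Q" "1 = e * v" by (auto simp: dvd_in_def)
      have "(e * h) * v = h" using v by (metis mult.assoc mult.commute mult_1_right)
      then show ?thesis using poly.dvd_in_mult[OF eQ(2) v(1)] by (simp only: \<open>e * h * v = h\<close> simp_thms)
    next
      case False
      then have "degree c \<le> degree e" using min eQ k by blast
      then have "degree k = 0" using k k0 e(2) by (simp add: degree_mult_eq)
      then have "dvd_in ?Q k 1" using primitive_degree_0_unit ek k0 by blast
      then obtain v where v: "v \<in> ?Q" "1 = k * v" by (auto simp: dvd_in_def)
      have "g = c * (v * l)" using v k l by (metis mult.assoc mult.commute mult_1_right)
      then show ?thesis using v l by (auto simp: dvd_in_def)
    qed
  qed
  then show ?thesis using cQ nonunit unfolding prime_in_def by blast
qed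

lemma primitive_prime_products:
  assumes "primitive g" "g \<noteq> 0"
  shows "g \<in> prime_products (polys_over S)"
  using assms
proof (induction "degree g" arbitrary: g rule: less_induct)
  case less
  let ?Q = "polys_over S"
  have gQ: "g \<in> ?Q" using less by (simp add: primitive_def)
  show ?case
  proof (cases "degree g = 0")
    case True
    then show ?thesis using primitive_degree_0_unit less.prems gQ prime_products.unit by blast
  next
    case False
    let ?D = "\<lambda>c. c \<in> ?Q \<and> degree c > 0 \<and> dvd_in ?Q c g"
    have "?D g" using False gQ poly.dvd_in_triv[of 1 g] by simp
    then obtain c where c: "?D c" and min: "\<And>a. ?D a \<Longrightarrow> degree c \<le> degree a"
      using ex_has_least_nat[of ?D g degree] by blast
    from c obtain b where b: "b \<in> ?Q" "g = c * b" by (auto simp: dvd_in_def)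
    have prim: "primitive c" "primitive b" using primitive_dvd[OF less.prems(1) b(2)] b c by auto
    have nz: "c \<noteq> 0" "b \<noteq> 0" using b less.prems by auto
    have "prime_in ?Q c"
    proof (rule minimal_divisor_prime[OF prim(1)])
      fix a d assume "a \<in> ?Q" "d \<in> ?Q" "c = a * d" "degree a > 0"
      then show "degree c \<le> degree a"
        using c min[of a] poly.dvd_in_trans[of a c g] poly.dvd_in_triv[of d a] by auto
    qed (use c in auto)
    moreover have "degree b < degree g" using b nz c by (simp add: degree_mult_eq)
    ultimately show ?thesis using less.hyps[of b] prim nz b(2) prime_products.prime by blast
  qed
qed

theorem factorial_polys_over: "factorial_subdomain (polys_over S)"
proof
  fix f assume "f \<in> polys_over S" "f \<noteq> 0"
  then obtain s g where "s \<in> S" "s \<noteq> 0" "primitive g" "f = [:s:] * g"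
    by (rule extract_content)
  then show "f \<in> prime_products (polys_over S)"
    using \<open>f \<noteq> 0\<close> poly.prime_products_mult[OF prime_products_const[OF factorial] primitive_prime_products]
    by (metis mult_zero_right)
qed

end

section \<open>Homomorphic images, localisation and adjunction of elements\<close>

lemma subdomain_image:
  fixes h :: "'a :: idom \<Rightarrow> 'b :: idom"
  assumes "subdomain S"
    and diff: "\<And>a b. h (a - b) = h a - h b"
    and mult: "\<And>a b. h (a * b) = h a * h b"
    and one: "h 1 = 1"
  shows "subdomain (h ` S)"
proof
  interpret subdomain S by fact
  show "0 \<in> h ` S" using diff[of 0 0] by (intro image_eqI[of _ _ 0]) auto
  show "1 \<in> h ` S" using one by (intro image_eqI[of _ _ 1]) auto
  fix a b assume "a \<in> h ` S" "b \<in> h ` S"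
  then show "a - b \<in> h ` S" "a * b \<in> h ` S"
    by (auto simp flip: diff mult)
qed

lemma factorial_subdomain_image:
  fixes h :: "'a :: idom \<Rightarrow> 'b :: idom"
  assumes "factorial_subdomain S"
    and diff: "\<And>a b. h (a - b) = h a - h b"
    and mult: "\<And>a b. h (a * b) = h a * h b"
    and one: "h 1 = 1"
    and inj: "\<And>a. a \<in> S \<Longrightarrow> h a = 0 \<Longrightarrow> a = 0"
  shows "factorial_subdomain (h ` S)"
proof -
  interpret factorial_subdomain S by fact
  have zero: "h 0 = 0" using diff[of 0 0] by simp
  interpret I: subdomain "h ` S"
    using subdomain_axioms diff mult one by (rule subdomain_image)
  have inj': "h a = h b \<longleftrightarrow> a = b" if "a \<in> S" "b \<in> S" for a b
    using inj[of "a - b"] that diff by auto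
  have dvd: "dvd_in (h ` S) (h a) (h b) \<longleftrightarrow> dvd_in S a b" if "a \<in> S" "b \<in> S" for a b
    using that unfolding dvd_in_def by (auto simp flip: mult simp: inj')
  have unit: "dvd_in (h ` S) (h a) 1 \<longleftrightarrow> dvd_in S a 1" if "a \<in> S" for a
    using dvd[OF that one_closed] one by simp
  have prime: "prime_in (h ` S) (h p)" if "prime_in S p" for p
    using that inj unfolding prime_in_def by (auto simp: dvd unit simp flip: mult)
  have "h x \<in> prime_products (h ` S)" if "x \<in> prime_products S" for x
    using that
    by (induction rule: prime_products.induct)
      (auto simp: mult unit intro: prime_products.intros prime)
  then show ?thesis
    using factorial zero by unfold_locales auto
qed

lemma factorial_range_of_int:
  assumes "\<And>n :: int. of_int n = (0 :: 'a :: idom) \<Longrightarrow> n = 0"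
  shows "factorial_subdomain (range of_int :: 'a set)"
proof (rule factorial_subdomain_image)
  have [simp]: "dvd_in UNIV a b \<longleftrightarrow> a dvd b" for a b :: int
    by (auto simp: dvd_in_def dvd_def)
  show "factorial_subdomain (UNIV :: int set)"
  proof
    fix x :: int assume "x \<noteq> 0"
    then show "x \<in> prime_products UNIV"
    proof (induction x rule: prime_divisors_induct)
      case (factor p x)
      then show ?case
        by (intro prime_products.prime)
          (auto simp: prime_in_def prime_dvd_mult_iff not_prime_unit)
    qed (auto intro: prime_products.unit)
  qed auto
qed (use assms in auto)


text \<open>
  A prime of \<open>S\<close> becomes a unit in the larger ring or stays prime there: clearing denominators moves
  a divisibility \<open>p dvd a * b\<close> into \<open>S\<close>, where \<open>p\<close> cannot divide the denominators, which are units,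
  unless it is a unit itself.
\<close>

lemma factorial_localization:
  fixes S :: "'a :: idom set"
  assumes "factorial_subdomain S"
    and denominator: "\<And>f. \<exists>m\<in>S. m dvd 1 \<and> m * f \<in> S"
  shows "factorial_subdomain (UNIV :: 'a set)"
proof
  interpret factorial_subdomain S by fact
  have dvd_UNIV: "dvd_in UNIV a b \<longleftrightarrow> a dvd b" for a b :: 'a
    by (auto simp: dvd_in_def dvd_def)
  have dvd: "a dvd b" if "dvd_in S a b" for a b
    using that by (auto simp: dvd_in_def)
  have cancel: "a dvd b" if "a dvd m * b" "m dvd 1" for a b m :: 'a
  proof -
    from that obtain v where v: "1 = m * v" by (auto simp: dvd_def)
    have "v * (m * b) = b" using v by (metis mult.assoc mult.commute mult_1)
    then show ?thesis using dvd_mult[OF that(1), of v] by (simp only:)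
  qed
  have prime_UNIV: "prime_in UNIV p" if p: "prime_in S p" "\<not> p dvd 1" for p
  proof -
    have "p dvd a \<or> p dvd b" if "p dvd a * b" for a b
    proof -
      from that obtain c where c: "a * b = p * c" by (auto simp: dvd_def)
      obtain k where k: "k \<in> S" "k dvd 1" "k * a \<in> S" using denominator by blast
      obtain l where l: "l \<in> S" "l dvd 1" "l * b \<in> S" using denominator by blast
      obtain m where m: "m \<in> S" "m dvd 1" "m * c \<in> S" using denominator by blast
      have "m * ((k * a) * (l * b)) = k * l * m * (a * b)" by (simp add: ac_simps)
      also have "\<dots> = p * (k * l * (m * c))" by (simp add: c ac_simps)
      finally have "dvd_in S p (m * ((k * a) * (l * b)))"
        using k l m by (simp only: dvd_in_triv mult_closed)
      then have "dvd_in S p m \<or> dvd_in S p (k * a) \<or> dvd_in S p (l * b)"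
        using p k l m unfolding prime_in_def by (meson mult_closed)
      moreover have "\<not> dvd_in S p m"
        using dvd p(2) m(2) dvd_trans by blast
      ultimately show ?thesis using dvd cancel k l by blast
    qed
    then show ?thesis using p by (auto simp: prime_in_def dvd_UNIV)
  qed
  interpret U: subdomain "UNIV :: 'a set" by unfold_locales auto
  have products: "x \<in> prime_products UNIV" if "x \<in> prime_products S" for x
    using that
  proof (induction rule: prime_products.induct)
    case (unit u)
    then show ?case using dvd by (auto intro!: prime_products.unit simp: dvd_UNIV)
  next
    case (prime p x)
    then show ?case
      using prime_UNIV[of p] by (cases "p dvd 1")
        (auto intro: prime_products.prime U.prime_products_unit_mult simp: dvd_UNIV)
  qed
  fix f :: 'a assume "f \<noteq> 0"
  obtain m where m: "m \<in> S" "m dvd 1" "m * f \<in> S" using denominator by blast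
  then obtain v where v: "1 = m * v" by (auto simp: dvd_def)
  have "m * f \<in> prime_products UNIV"
    using m \<open>f \<noteq> 0\<close> v by (intro products factorial) auto
  then have "v * (m * f) \<in> prime_products UNIV"
    by (rule U.prime_products_unit_mult) (simp_all add: dvd_UNIV, metis v dvd_triv_right)
  moreover have "v * (m * f) = f" using v by (metis mult.assoc mult.commute mult_1)
  ultimately show "f \<in> prime_products UNIV" by (simp only:)
qed auto

text \<open>
  The subring generated by a list of elements, built one element at a time so that each step is the image
  of a polynomial ring over the previous one.
\<close>

primrec adjoin :: "'a :: idom list \<Rightarrow> 'a set" where
  "adjoin [] = range of_int"
| "adjoin (t # ts) = (\<lambda>p. poly p t) ` polys_over (adjoin ts)"

lemma subdomain_adjoin: "subdomain (adjoin ts)"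
proof (induction ts)
  case Nil
  have "subdomain (UNIV :: int set)" by unfold_locales auto
  then show ?case unfolding adjoin.simps by (rule subdomain_image) auto
next
  case (Cons t ts)
  show ?case
    unfolding adjoin.simps by (rule subdomain_image[OF subdomain.subdomain_polys_over[OF Cons]]) auto
qed

lemma set_subset_adjoin: "set ts \<subseteq> adjoin ts"
proof (induction ts)
  case (Cons t ts)
  interpret subdomain "adjoin ts" by (rule subdomain_adjoin)
  have "t \<in> adjoin (t # ts)"
    by (auto intro!: image_eqI[of _ _ "[:0, 1:]"] simp: polys_over_def coeff_pCons split: nat.splits)
  moreover have "a \<in> adjoin (t # ts)" if "a \<in> adjoin ts" for a
    using that by (auto intro!: image_eqI[of _ _ "[:a:]"])
  ultimately show ?case using Cons by auto
qed simp

section \<open>Laurent polynomials\<close>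

definition laurent_coeff :: "'d :: finite laurent \<Rightarrow> ('d \<Rightarrow>\<^sub>0 int) \<Rightarrow> int" where
  "laurent_coeff f = Poly_Mapping.lookup (poly_of_laurent f)"

definition laurent_monom :: "('d :: finite \<Rightarrow>\<^sub>0 int) \<Rightarrow> 'd laurent" where
  "laurent_monom e = laurent_of_poly (Poly_Mapping.single e 1)"

lemma poly_of_laurent_monom: "poly_of_laurent (laurent_monom e) = Poly_Mapping.single e 1"
  by (simp add: laurent_monom_def laurent_of_poly_inverse)

lemma laurent_eqI: "(\<And>e. laurent_coeff f e = laurent_coeff g e) \<Longrightarrow> f = g"
  by (metis laurent_coeff_def poly_mapping_eqI poly_of_laurent_inject)

lemma laurent_coeff_add: "laurent_coeff (f + g) e = laurent_coeff f e + laurent_coeff g e"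
  by (simp add: laurent_coeff_def plus_laurent.rep_eq lookup_add)

lemma laurent_coeff_0 [simp]: "laurent_coeff 0 e = 0"
  by (simp add: laurent_coeff_def zero_laurent.rep_eq)

lemma laurent_coeff_sum: "laurent_coeff (sum f I) e = (\<Sum>i\<in>I. laurent_coeff (f i) e)"
  by (induction I rule: infinite_finite_induct) (auto simp: laurent_coeff_add)

lemma laurent_of_int: "of_int n = laurent_of_poly (Poly_Mapping.single 0 n)"
proof -
  have "poly_of_laurent (of_nat m :: 'a laurent) = of_nat m" for m
    by (induction m) (auto simp: zero_laurent.rep_eq one_laurent.rep_eq plus_laurent.rep_eq)
  then have "poly_of_laurent (of_int n :: 'a laurent) = of_int n"
    by (cases n rule: int_diff_cases) (simp add: minus_laurent.rep_eq)
  then show ?thesis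
    by (metis poly_of_laurent_inverse single_of_int of_int_eq_id id_apply)
qed

lemma laurent_coeff_of_int: "laurent_coeff (of_int n) e = (n when e = 0)"
  unfolding laurent_of_int by (simp add: laurent_coeff_def laurent_of_poly_inverse lookup_single when_def)

lemma laurent_coeff_mult_monom:
  "laurent_coeff (f * laurent_monom m) e = laurent_coeff f (e - m)"
proof -
  let ?f = "poly_of_laurent f"
  have "Poly_Mapping.lookup (?f * Poly_Mapping.single m 1) e =
    (\<Sum>l. Poly_Mapping.lookup ?f l * (\<Sum>q. (1 when m = q) when e = l + q))"
    by (simp only: lookup_mult lookup_single)
  also have "\<dots> = (\<Sum>l. Poly_Mapping.lookup ?f l when l = e - m)"
  proof (intro Sum_any.cong)
    fix l
    have "(\<Sum>q. ((1::int) when m = q) when e = l + q) = (\<Sum>q. (1 when e = l + q) when q = m)"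
      by (intro Sum_any.cong) (auto simp: when_def)
    also have "\<dots> = (1 when e = l + m)" by simp
    finally show "Poly_Mapping.lookup ?f l * (\<Sum>q. (1 when m = q) when e = l + q) =
        (Poly_Mapping.lookup ?f l when l = e - m)"
      by (auto simp: when_def algebra_simps)
  qed
  finally show ?thesis
    by (simp add: laurent_coeff_def times_laurent.rep_eq poly_of_laurent_monom)
qed

lemma laurent_monom_0: "laurent_monom 0 = 1"
  by (simp add: laurent_monom_def one_laurent_def)

lemma laurent_monom_add: "laurent_monom (a + b) = laurent_monom a * laurent_monom b"
  by (metis mult_1 mult_single poly_of_laurent_inject poly_of_laurent_monom times_laurent.rep_eq)

lemma laurent_monom_sum: "laurent_monom (sum f I) = (\<Prod>i\<in>I. laurent_monom (f i))"
  by (induction I rule: infinite_finite_induct) (auto simp: laurent_monom_0 laurent_monom_add)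

lemma laurent_monom_unit: "laurent_monom a dvd 1"
  by (rule dvdI[of _ _ "laurent_monom (- a)"]) (simp add: laurent_monom_0 flip: laurent_monom_add)

definition laurent_var :: "'d :: finite \<Rightarrow> 'd laurent" where
  "laurent_var v = laurent_monom (Poly_Mapping.single v 1)"

lemma laurent_var_power: "laurent_var v ^ n = laurent_monom (Poly_Mapping.single v (int n))"
  by (induction n) (auto simp: laurent_monom_0 laurent_var_def simp flip: laurent_monom_add single_add)

lemma laurent_coeff_poly_var:
  "laurent_coeff (poly p (laurent_var v)) e =
     (\<Sum>i\<le>degree p. laurent_coeff (coeff p i) (e - Poly_Mapping.single v (int i)))"
  by (simp add: poly_altdef laurent_coeff_sum laurent_var_power laurent_coeff_mult_monom)

text \<open>
  For \<open>v\<close> the next variable to be adjoined, this ensures that multiples of distinct powers of \<open>v\<close> by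
  elements of the ring built so far have disjoint supports.
\<close>

lemma laurent_coeff_adjoin:
  assumes "f \<in> adjoin (map laurent_var vs)" "v \<notin> set vs" "Poly_Mapping.lookup e v \<noteq> 0"
  shows "laurent_coeff f e = 0"
  using assms
proof (induction vs arbitrary: f e)
  case Nil
  then show ?case by (auto simp: laurent_coeff_of_int when_def)
next
  case (Cons w vs)
  then obtain p where p: "p \<in> polys_over (adjoin (map laurent_var vs))" "f = poly p (laurent_var w)"
    by auto
  have "laurent_coeff (coeff p i) (e - Poly_Mapping.single w (int i)) = 0" for i
    using Cons p(1) by (intro Cons.IH) (auto simp: polys_over_def lookup_minus lookup_single)
  then show ?case by (simp add: p laurent_coeff_poly_var)
qed

text \<open>
  In every monomial of the summand \<open>c\<^sub>i * v ^ i\<close> of the value, \<open>v\<close> has exponent \<open>i\<close>, so distinct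
  summands cannot cancel. The coefficients of \<open>c\<^sub>j\<close> are read off at the exponents shifted by \<open>v ^ j\<close>.
\<close>

lemma laurent_var_transcendental:
  assumes p: "p \<in> polys_over (adjoin (map laurent_var vs))"
    and v: "v \<notin> set vs" and root: "poly p (laurent_var v) = 0"
  shows "p = 0"
proof (rule poly_eqI)
  fix j
  have in_adjoin: "coeff p i \<in> adjoin (map laurent_var vs)" for i
    using p by (auto simp: polys_over_def)
  show "coeff p j = coeff 0 j"
  proof (rule laurent_eqI)
    fix e
    show "laurent_coeff (coeff p j) e = laurent_coeff (coeff 0 j) e"
    proof (cases "Poly_Mapping.lookup e v = 0 \<and> j \<le> degree p")
      case True
      let ?e = "e + Poly_Mapping.single v (int j)"
      have "0 = (\<Sum>i\<le>degree p. laurent_coeff (coeff p i) (?e - Poly_Mapping.single v (int i)))"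
        using root laurent_coeff_poly_var[of p v ?e] by simp
      also have "\<dots> = (\<Sum>i\<in>{j}. laurent_coeff (coeff p i) (?e - Poly_Mapping.single v (int i)))"
        using True by (intro sum.mono_neutral_right)
          (auto intro!: laurent_coeff_adjoin[OF in_adjoin v] simp: lookup_minus lookup_add)
      finally show ?thesis by simp
    next
      case False
      then show ?thesis
        using laurent_coeff_adjoin[OF in_adjoin v, of e j] by (auto simp: coeff_eq_0)
    qed
  qed
qed

lemma factorial_adjoin_vars:
  "distinct vs \<Longrightarrow> factorial_subdomain (adjoin (map laurent_var (vs :: 'd :: finite list)))"
proof (induction vs)
  case Nil
  have "n = 0" if "of_int n = (0 :: 'd laurent)" for n
    using arg_cong[OF that, of "\<lambda>f. laurent_coeff f 0"] by (simp add: laurent_coeff_of_int)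
  then show ?case by (auto intro: factorial_range_of_int)
next
  case (Cons v vs)
  show ?case
    unfolding list.map adjoin.simps
    by (rule factorial_subdomain_image[OF factorial_subdomain.factorial_polys_over])
      (use Cons laurent_var_transcendental in auto)
qed

lemma exponent_sum: "e = (\<Sum>v\<in>UNIV. Poly_Mapping.single v (Poly_Mapping.lookup e v))"
  for e :: "'d :: finite \<Rightarrow>\<^sub>0 int"
  by (rule poly_mapping_eqI) (simp add: lookup_sum lookup_single when_def)

lemma laurent_sum_monom:
  "f = (\<Sum>e\<in>Poly_Mapping.keys (poly_of_laurent f). of_int (laurent_coeff f e) * laurent_monom e)"
proof (rule laurent_eqI)
  fix a
  have "(\<Sum>e\<in>Poly_Mapping.keys (poly_of_laurent f). laurent_coeff f e when a = e) = laurent_coeff f a"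
    by (simp add: when_def laurent_coeff_def in_keys_iff)
  then show "laurent_coeff f a =
    laurent_coeff (\<Sum>e\<in>Poly_Mapping.keys (poly_of_laurent f). of_int (laurent_coeff f e) * laurent_monom e) a"
    by (simp add: laurent_coeff_sum laurent_coeff_mult_monom laurent_coeff_of_int)
qed

text \<open>
  The elements that some unit lying in the subring multiplies into it form a ring. It contains the
  integers and the powers of each variable with exponents of either sign, which generate all Laurent
  polynomials.
\<close>

lemma laurent_denominator:
  assumes "set vs = (UNIV :: 'd :: finite set)"
  shows "\<exists>m\<in>adjoin (map laurent_var vs). m dvd 1 \<and> m * f \<in> adjoin (map laurent_var vs)"
proof -
  let ?S = "adjoin (map laurent_var vs)"
  interpret subdomain ?S by (rule subdomain_adjoin)
  define C where "C = {f. \<exists>m\<in>?S. m dvd 1 \<and> m * f \<in> ?S}"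
  have S: "f \<in> C" if "f \<in> ?S" for f
    using that by (auto simp: C_def intro!: bexI[of _ 1])
  have add: "f + g \<in> C" and mult: "f * g \<in> C" if "f \<in> C" "g \<in> C" for f g
  proof -
    from that obtain k l where k: "k \<in> ?S" "k dvd 1" "k * f \<in> ?S" and l: "l \<in> ?S" "l dvd 1" "l * g \<in> ?S"
      by (auto simp: C_def)
    have kl: "k * l \<in> ?S" "k * l dvd 1" using k l mult_dvd_mono[of k 1 l 1] by auto
    have "(k * l) * (f + g) = l * (k * f) + k * (l * g)" by (simp add: algebra_simps)
    then have "(k * l) * (f + g) \<in> ?S" using k l by simp
    with kl show "f + g \<in> C" unfolding C_def by blast
    have "(k * l) * (f * g) = (k * f) * (l * g)" by (simp add: ac_simps)
    then have "(k * l) * (f * g) \<in> ?S" using k l by (simp only: mult_closed)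
    with kl show "f * g \<in> C" unfolding C_def by blast
  qed
  have power: "a ^ n \<in> ?S" if "a \<in> ?S" for a n
    using that by (induction n) auto
  have int: "of_int n \<in> ?S" for n
  proof -
    have "of_nat k \<in> ?S" for k by (induction k) auto
    then show ?thesis by (cases n rule: int_diff_cases) auto
  qed
  have var: "laurent_var v \<in> ?S" for v
    using set_subset_adjoin[of "map laurent_var vs"] assms by auto
  have single: "laurent_monom (Poly_Mapping.single v k) \<in> C" for v k
  proof (cases "k \<ge> 0")
    case True
    then have "laurent_monom (Poly_Mapping.single v k) = laurent_var v ^ nat k"
      by (simp add: laurent_var_power)
    then show ?thesis using power[OF var] by (intro S) simp
  next
    case False
    then have "laurent_var v ^ nat (- k) * laurent_monom (Poly_Mapping.single v k) = 1"
      by (simp add: laurent_var_power laurent_monom_0 flip: laurent_monom_add single_add)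
    moreover have "laurent_var v ^ nat (- k) dvd 1"
      by (simp add: laurent_var_power laurent_monom_unit)
    ultimately show ?thesis using power[OF var] by (auto simp: C_def intro!: bexI[of _ "laurent_var v ^ nat (- k)"])
  qed
  have monom: "laurent_monom e \<in> C" for e
  proof -
    have "(\<Prod>v\<in>I. laurent_monom (Poly_Mapping.single v (Poly_Mapping.lookup e v))) \<in> C" for I
      by (induction I rule: infinite_finite_induct) (auto intro: S mult single)
    then show ?thesis by (subst exponent_sum) (simp add: laurent_monom_sum)
  qed
  have "(\<Sum>e\<in>I. of_int (laurent_coeff f e) * laurent_monom e) \<in> C" for I
    by (induction I rule: infinite_finite_induct) (auto intro: S add mult monom int)
  then have "f \<in> C" by (subst laurent_sum_monom) simp
  then show ?thesis by (simp add: C_def)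
qed

theorem factorial_laurent: "factorial_subdomain (UNIV :: 'd :: finite laurent set)"
proof -
  obtain vs :: "'d list" where vs: "set vs = UNIV" "distinct vs"
    using finite_distinct_list[OF finite_UNIV] by blast
  show ?thesis
    using factorial_localization[OF factorial_adjoin_vars[OF vs(2)] laurent_denominator[OF vs(1)]] .
qed

section \<open>Prime colon ideals of principal ideals\<close>

text \<open>
  The ideal quotient of the principal ideal of \<open>D\<close> by the ideal generated by \<open>W\<close>.
\<close>

definition colon_ideal :: "'a :: idom \<Rightarrow> 'a set \<Rightarrow> 'a set" where
  "colon_ideal D W = {f. \<forall>w\<in>W. D dvd f * w}"

lemma prime_product_prime_mem:
  assumes "x \<in> prime_products (UNIV :: 'a :: idom set)" "x \<in> P"
    and unit: "\<And>u. u dvd 1 \<Longrightarrow> u \<notin> P"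
    and prime: "\<And>a b. a * b \<in> P \<Longrightarrow> a \<in> P \<or> b \<in> P"
  obtains p where "prime_elem p" "p \<in> P"
proof -
  have dvd_UNIV: "dvd_in UNIV a b \<longleftrightarrow> a dvd b" for a b :: 'a
    by (auto simp: dvd_in_def dvd_def)
  have "\<exists>p. prime_elem p \<and> p \<in> P"
    using assms(1,2)
  proof (induction rule: prime_products.induct)
    case (unit u)
    then show ?case using assms(3) by (auto simp: dvd_UNIV)
  next
    case (prime p x)
    then show ?case using assms(4)[of p x] by (auto simp: prime_in_def prime_elem_def dvd_UNIV)
  qed
  with that show ?thesis by blast
qed

text \<open>
  A prime \<open>p\<close> in the colon ideal divides \<open>D\<close>: for \<open>w\<^sub>0 \<in> W\<close> not divisible by \<open>D\<close>, write
  \<open>p * w\<^sub>0 = D * x\<close>; if \<open>p\<close> divided \<open>x\<close>, cancelling it would make \<open>D\<close> divide \<open>w\<^sub>0\<close>. With \<open>D = p * E\<close>,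
  cancelling \<open>E\<close> turns the condition on \<open>f\<close> into divisibility of \<open>f * (w / E)\<close> by \<open>p\<close>.
\<close>

lemma prime_colon_ideal_principal:
  fixes D :: "'a :: idom"
  assumes fact: "factorial_subdomain (UNIV :: 'a set)" and "D \<noteq> 0"
    and proper: "1 \<notin> colon_ideal D W"
    and prime: "\<And>a b. a * b \<in> colon_ideal D W \<Longrightarrow> a \<in> colon_ideal D W \<or> b \<in> colon_ideal D W"
  obtains p where "prime_elem p" "p dvd D" "colon_ideal D W = {f. p dvd f}"
proof -
  let ?Q = "colon_ideal D W"
  have unit: "u \<notin> ?Q" if "u dvd 1" for u
  proof
    assume "u \<in> ?Q"
    from that obtain v where "1 = u * v" by (auto simp: dvd_def)
    have "D dvd w" if "w \<in> W" for w
    proof -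
      have "D dvd v * (u * w)" using \<open>u \<in> ?Q\<close> that by (auto simp: colon_ideal_def)
      then show ?thesis using \<open>1 = u * v\<close> by (metis mult.assoc mult.commute mult_1)
    qed
    with proper show False by (auto simp: colon_ideal_def)
  qed
  have "D \<in> prime_products UNIV" using factorial_subdomain.factorial[OF fact] \<open>D \<noteq> 0\<close> by auto
  moreover have "D \<in> ?Q" by (auto simp: colon_ideal_def)
  ultimately obtain p where p: "prime_elem p" "p \<in> ?Q"
    by (rule prime_product_prime_mem) (use unit prime in auto)
  obtain w0 where w0: "w0 \<in> W" "\<not> D dvd w0"
    using proper by (auto simp: colon_ideal_def)
  obtain E where E: "D = p * E"
  proof -
    obtain x where x: "p * w0 = D * x" using p(2) w0 by (auto simp: colon_ideal_def dvd_def)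
    have "\<not> p dvd x"
    proof
      assume "p dvd x"
      then obtain y where "x = p * y" by (auto simp: dvd_def)
      then have "p * w0 = p * (D * y)" using x by (simp add: mult.left_commute)
      then have "w0 = D * y" using p by (metis mult_left_cancel prime_elem_not_zeroI)
      then show False using w0 by auto
    qed
    then have "p dvd D" using p(1) x by (metis dvd_triv_left prime_elem_dvd_mult_iff)
    then show ?thesis using that by (auto simp: dvd_def)
  qed
  have p0: "p \<noteq> 0" "E \<noteq> 0" using E \<open>D \<noteq> 0\<close> by auto
  have quot: "E dvd w" if "w \<in> W" for w
    using p(2) that p0 by (auto simp: colon_ideal_def E)
  obtain v0 where v0: "w0 = E * v0" using quot[OF w0(1)] by (auto simp: dvd_def)
  have "\<not> p dvd v0" using w0(2) p0 by (simp add: v0 E mult.commute[of p])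
  have "p dvd f" if "f \<in> ?Q" for f
  proof -
    have "D dvd f * w0" using that w0 by (auto simp: colon_ideal_def)
    then have "E * p dvd E * (f * v0)" by (simp add: E v0 ac_simps)
    then have "p dvd f * v0" using p0 by simp
    then show ?thesis using p(1) \<open>\<not> p dvd v0\<close> by (simp add: prime_elem_dvd_mult_iff)
  qed
  moreover have "f \<in> ?Q" if "p dvd f" for f
    using that quot by (auto simp: colon_ideal_def E intro: mult_dvd_mono)
  ultimately show ?thesis using that[of p] p E by auto
qed

section \<open>Annihilators in the cokernel\<close>

lemma mult_mat_smult_vec:
  fixes A :: "'a :: comm_ring_1 mat"
  assumes "A \<in> carrier_mat m n" "x \<in> carrier_vec n"
  shows "A *\<^sub>v (c \<cdot>\<^sub>v x) = c \<cdot>\<^sub>v (A *\<^sub>v x)"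
  using assms by (intro eq_vecI) auto

text \<open>
  Scalar multiplication on the quotient is a union of cosets over all representatives \<open>x\<close> of a class.
  Any one of them can serve as \<open>v\<close>: the others differ from it by an element of the image of \<open>A\<close>, so
  \<open>f \<cdot>\<^sub>v x\<close> lies in the image as soon as \<open>f \<cdot>\<^sub>v v\<close> does.
\<close>

lemma cokernel_annihilator_representative:
  fixes A :: "'a :: comm_ring_1 mat"
  assumes X: "X \<in> carrier (cokernel A)"
  obtains v where "v \<in> carrier_vec (dim_row A)"
    "\<And>f. f \<odot>\<^bsub>cokernel A\<^esub> X = \<zero>\<^bsub>cokernel A\<^esub> \<longleftrightarrow> (\<exists>x\<in>carrier_vec (dim_col A). f \<cdot>\<^sub>v v = A *\<^sub>v x)"
proof -
  let ?V = "module_vec TYPE('a) (dim_row A)"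
  let ?N = "(\<lambda>x. A *\<^sub>v x) ` carrier_vec (dim_col A)"
  have A: "A \<in> carrier_mat (dim_row A) (dim_col A)" by simp
  have N: "?N \<subseteq> carrier_vec (dim_row A)" by (auto intro: carrier_vecI)
  have zero: "0\<^sub>v (dim_row A) \<in> ?N"
    by (rule image_eqI[of _ _ "0\<^sub>v (dim_col A)"]) auto
  have minus: "a - b \<in> ?N" if "a \<in> ?N" "b \<in> ?N" for a b
    using that by (auto simp: mult_minus_distrib_mat_vec[OF A, symmetric])
  have add: "a + b \<in> ?N" if "a \<in> ?N" "b \<in> ?N" for a b
    using that by (auto simp: mult_add_distrib_mat_vec[OF A, symmetric])
  have smult: "c \<cdot>\<^sub>v a \<in> ?N" if "a \<in> ?N" for a c
    using that by (auto simp: mult_mat_smult_vec[OF A, symmetric])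
  have coset: "?N +>\<^bsub>?V\<^esub> a = {h + a |h. h \<in> ?N}" for a
    by (auto simp: a_r_coset_def' module_vec_simps)
  from X obtain v where v: "v \<in> carrier_vec (dim_row A)" "X = ?N +>\<^bsub>?V\<^esub> v"
    by (auto simp: cokernel_def quot_module_def A_RCOSETS_def' module_vec_simps)
  have op: "f \<odot>\<^bsub>cokernel A\<^esub> X = (\<Union>x\<in>X. ?N +>\<^bsub>?V\<^esub> (f \<cdot>\<^sub>v x))" for f
    by (simp only: cokernel_def quot_module_def module.simps module_vec_simps)
  have z: "\<zero>\<^bsub>cokernel A\<^esub> = ?N"
    by (simp add: cokernel_def quot_module_def)
  have coset_eq: "?N +>\<^bsub>?V\<^esub> a = ?N" if "a \<in> ?N" for a
  proof -
    have "b = (b - a) + a" if "b \<in> ?N" for b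
      using that \<open>a \<in> ?N\<close> N by (intro eq_vecI) auto
    then show ?thesis unfolding coset using add minus \<open>a \<in> ?N\<close> by blast
  qed
  have self: "a \<in> ?N +>\<^bsub>?V\<^esub> a" if "a \<in> carrier_vec (dim_row A)" for a
  proof -
    have "a = 0\<^sub>v (dim_row A) + a" using that by simp
    then show ?thesis unfolding coset using zero by blast
  qed
  have "f \<odot>\<^bsub>cokernel A\<^esub> X = \<zero>\<^bsub>cokernel A\<^esub> \<longleftrightarrow> f \<cdot>\<^sub>v v \<in> ?N" for f
  proof
    assume "f \<odot>\<^bsub>cokernel A\<^esub> X = \<zero>\<^bsub>cokernel A\<^esub>"
    then have "?N +>\<^bsub>?V\<^esub> (f \<cdot>\<^sub>v v) \<subseteq> ?N" using self[OF v(1)] v(2) op z by blast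
    then show "f \<cdot>\<^sub>v v \<in> ?N" using self[of "f \<cdot>\<^sub>v v"] v(1) by auto
  next
    assume fv: "f \<cdot>\<^sub>v v \<in> ?N"
    have "?N +>\<^bsub>?V\<^esub> (f \<cdot>\<^sub>v x) = ?N" if "x \<in> X" for x
    proof -
      from that obtain h where h: "h \<in> ?N" "x = h + v" unfolding v(2) coset by blast
      then have "f \<cdot>\<^sub>v x = f \<cdot>\<^sub>v h + f \<cdot>\<^sub>v v"
        using N v(1) by (auto intro!: smult_add_distrib_vec)
      then show ?thesis using add smult h fv coset_eq by simp
    qed
    moreover have "X \<noteq> {}" using self v by blast
    ultimately show "f \<odot>\<^bsub>cokernel A\<^esub> X = \<zero>\<^bsub>cokernel A\<^esub>" unfolding op z by auto
  qed
  then show ?thesis using that[of v] v(1) by (auto simp: image_iff)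
qed

text \<open>
  Both directions come from \<open>adj A \<cdot> A = A \<cdot> adj A = det A\<close>: if \<open>adj A \<cdot> v = det A \<cdot> x\<close>, applying \<open>A\<close>
  gives \<open>det A \<cdot> v = det A \<cdot> A x\<close>, and \<open>det A\<close> cancels.
\<close>

lemma mem_image_iff_det_dvd_adj:
  fixes A :: "'a :: idom mat"
  assumes A: "A \<in> carrier_mat n n" and det: "det A \<noteq> 0" and v: "v \<in> carrier_vec n"
  shows "(\<exists>x\<in>carrier_vec n. v = A *\<^sub>v x) \<longleftrightarrow> (\<forall>i<n. det A dvd (adj_mat A *\<^sub>v v) $ i)"
proof -
  let ?B = "adj_mat A"
  note B = adj_mat[OF A]
  have BA: "?B *\<^sub>v (A *\<^sub>v x) = det A \<cdot>\<^sub>v x" if "x \<in> carrier_vec n" for x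
    using that A B by (simp flip: assoc_mult_mat_vec) (auto intro!: eq_vecI)
  have AB: "A *\<^sub>v (?B *\<^sub>v x) = det A \<cdot>\<^sub>v x" if "x \<in> carrier_vec n" for x
    using that A B by (simp flip: assoc_mult_mat_vec) (auto intro!: eq_vecI)
  show ?thesis
  proof
    assume "\<exists>x\<in>carrier_vec n. v = A *\<^sub>v x"
    then show "\<forall>i<n. det A dvd (?B *\<^sub>v v) $ i" by (auto simp: BA)
  next
    assume "\<forall>i<n. det A dvd (?B *\<^sub>v v) $ i"
    then obtain y where y: "\<And>i. i < n \<Longrightarrow> (?B *\<^sub>v v) $ i = det A * y i"
      unfolding dvd_def by metis
    let ?x = "vec n y"
    have "?B *\<^sub>v v = det A \<cdot>\<^sub>v ?x" using y B by (intro eq_vecI) auto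
    then have "det A \<cdot>\<^sub>v v = det A \<cdot>\<^sub>v (A *\<^sub>v ?x)"
      using AB[OF v] mult_mat_smult_vec[OF A, of ?x "det A"] by simp
    then have "v = A *\<^sub>v ?x"
      using det v A by (auto simp: vec_eq_iff)
    then show "\<exists>x\<in>carrier_vec n. v = A *\<^sub>v x" by auto
  qed
qed

lemma det_nonzero_of_full_rank:
  fixes A :: "'a :: idom mat"
  assumes A: "A \<in> carrier_mat n n" and rank: "vec_space.rank n (map_mat to_fract A) = n"
  shows "det A \<noteq> 0"
proof
  assume "det A = 0"
  interpret h: comm_ring_hom "to_fract :: 'a \<Rightarrow> 'a fract"
    by unfold_locales auto
  have "det (map_mat to_fract A) = 0" using \<open>det A = 0\<close> by simp
  moreover have "map_mat to_fract A \<in> carrier_mat n n" using A by simp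
  ultimately show False using vec_space.det_rank_iff[of "map_mat to_fract A" n] rank by blast
qed

theorem lemma5p1:
  fixes A :: "'d::finite laurent mat"
    and M :: "('d laurent, 'm) module"
    and k n :: nat
    and P :: "'d laurent set"
  assumes "A \<in> carrier_mat k n"
    and "Module.module class_ring M"
    and "module_iso class_ring M (cokernel A)"
    and "k = n"
    and "vec_space.rank k (map_mat to_fract A) = k"
    and "associated_prime class_ring M P"
  shows "\<exists>\<pi>. irreducible \<pi> \<and> \<pi> dvd det A \<and> P = PIdl\<^bsub>class_ring\<^esub> \<pi>"
proof -
  have A: "A \<in> carrier_mat n n" and rank: "vec_space.rank n (map_mat to_fract A) = n"
    using assms by auto
  let ?R = "class_ring :: 'd laurent ring"
  have det: "det A \<noteq> 0" using det_nonzero_of_full_rank[OF A rank] .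
  obtain \<phi> where \<phi>: "mod_hom ?R M (cokernel A) \<phi>" "bij_betw \<phi> (carrier M) (carrier (cokernel A))"
    using assms(3) by (auto simp: module_iso_def)
  interpret \<phi>: mod_hom ?R M "cokernel A" \<phi> by (rule \<phi>(1))
  obtain m where P: "primeideal P ?R" and m: "m \<in> carrier M"
    and ann: "P = {f \<in> carrier ?R. f \<odot>\<^bsub>M\<^esub> m = \<zero>\<^bsub>M\<^esub>}"
    using assms(6) by (auto simp: associated_prime_def)
  interpret P: primeideal P ?R by (rule P)
  have "\<phi> m \<in> carrier (cokernel A)" using m \<phi>(2) by (auto simp: bij_betw_def)
  then obtain v where v: "v \<in> carrier_vec (dim_row A)"
    and v_ann: "\<And>f. f \<odot>\<^bsub>cokernel A\<^esub> \<phi> m = \<zero>\<^bsub>cokernel A\<^esub> \<longleftrightarrow> (\<exists>x\<in>carrier_vec (dim_col A). f \<cdot>\<^sub>v v = A *\<^sub>v x)"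
    by (rule cokernel_annihilator_representative) blast
  have v': "v \<in> carrier_vec n" using v A by auto
  have \<phi>_zero: "f \<odot>\<^bsub>M\<^esub> m = \<zero>\<^bsub>M\<^esub> \<longleftrightarrow> f \<odot>\<^bsub>cokernel A\<^esub> \<phi> m = \<zero>\<^bsub>cokernel A\<^esub>" for f
  proof -
    have f: "f \<in> carrier ?R" by (simp add: class_ring_simps)
    have "f \<odot>\<^bsub>M\<^esub> m \<in> carrier M" using f m by simp
    then have "\<phi> (f \<odot>\<^bsub>M\<^esub> m) = \<phi> \<zero>\<^bsub>M\<^esub> \<longleftrightarrow> f \<odot>\<^bsub>M\<^esub> m = \<zero>\<^bsub>M\<^esub>"
      using \<phi>(2) by (intro inj_on_eq_iff) (auto simp: bij_betw_def)
    then show ?thesis using f m by simp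
  qed
  define W where "W = {(adj_mat A *\<^sub>v v) $ i |i. i < n}"
  have "P = colon_ideal (det A) W"
  proof -
    have "f \<in> P \<longleftrightarrow> f \<in> colon_ideal (det A) W" for f
    proof -
      have "f \<in> P \<longleftrightarrow> (\<exists>x\<in>carrier_vec n. f \<cdot>\<^sub>v v = A *\<^sub>v x)"
        using A by (simp add: ann class_ring_simps \<phi>_zero v_ann)
      also have "\<dots> \<longleftrightarrow> (\<forall>i<n. det A dvd (adj_mat A *\<^sub>v (f \<cdot>\<^sub>v v)) $ i)"
        using v' by (intro mem_image_iff_det_dvd_adj[OF A det]) auto
      also have "\<dots> \<longleftrightarrow> (\<forall>i<n. det A dvd f * (adj_mat A *\<^sub>v v) $ i)"
        using adj_mat(1)[OF A] by (simp add: mult_mat_smult_vec[OF adj_mat(1)[OF A] v'])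
      finally show ?thesis by (auto simp: colon_ideal_def W_def)
    qed
    then show ?thesis by blast
  qed
  moreover have "1 \<notin> P"
    using P.one_imp_carrier P.I_notcarr by (auto simp: class_ring_simps)
  moreover have "a \<in> P \<or> b \<in> P" if "a * b \<in> P" for a b
    using P.I_prime[of a b] that by (auto simp: class_ring_simps)
  ultimately obtain p where p: "prime_elem p" "p dvd det A" "P = {f. p dvd f}"
    using prime_colon_ideal_principal[OF factorial_laurent det, of W] by metis
  have "PIdl\<^bsub>?R\<^esub> p = {f. p dvd f}"
    by (auto simp: cgenideal_def class_ring_simps dvd_def mult.commute)
  then show ?thesis
    using p prime_elem_imp_irreducible by blast
qed

end
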